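(* Let $G=(N,E)$ be a finite simple undirected graph with $|E|\ge 1$ (not necessarily connected). Let $\mathrm{K}$ be the set of all simple cycles of $G$ and let $\Omega(G)$ be the set of all acyclic orientations of $G$. If $G$ is a forest (i.e. $\mathrm{K}=\emptyset$), then $\chi_{\rm int}^*(G)=2$. Otherwise, $$\chi_{\rm int}^*(G)=\min_{\omega\in\Omega(G)}\ \max_{\kappa\in \mathrm{K}}\ \frac{|\kappa|}{\min\bigl\{m(\kappa^+,\omega),\,m(\kappa^-,\omega)\bigr\}}.$$
   Context: For an integer $k\ge 1$, a $k$-tuple coloring of $G$ assigns to each node $i\in N$ $k$ distinct natural numbers (colors) $c_i^1,\ldots,c_i^k$ such that no two nodes joined by an edge share a color. It is interleaved if for every edge $(i,j)\in E$ either $c_i^1<c_j^1<c_i^2<c_j^2<\cdots<c_i^k<c_j^k$ or $c_j^1<c_i^1<c_j^2<c_i^2<\cdots<c_j^k<c_i^k$. The interleaved $k$-chromatic number $\chi_{\rm int}^k(G)$ is the least total number of distinct colors used by an interleaved $k$-tuple coloring of $G$. The interleaved multichromatic number of $G$ is $$\chi_{\rm int}^*(G)=\inf_{k\ge 1}\frac{\chi_{\rm int}^k(G)}{k}.$$ An acyclic orientation of $G$ is an assignment of a direction to each edge that creates no directed cycle. For a simple cycle $\kappa$ of $G$, $\kappa^+$ and $\kappa^-$ denote its two possible traversal directions, $m(\kappa^+,\omega)$ (respectively $m(\kappa^-,\omega)$) is the number of edges of $\kappa$ oriented by $\omega$ in the $\kappa^+$ (respectively $\kappa^-$) direction, and $|\kappa|=m(\kappa^+,\omega)+m(\kappa^-,\omega)$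 is the number of edges of $\kappa$. (Both $m(\kappa^\pm,\omega)$ are positive because $\omega$ is acyclic.) *)

theory Defs
  imports Complex_Main
begin

definition finite_simple_graph :: "'a set \<Rightarrow> 'a set set \<Rightarrow> bool" where
  "finite_simple_graph N E \<longleftrightarrow> finite N \<and> (\<forall>e\<in>E. e \<subseteq> N \<and> card e = 2)"

subsection \<open>Interleaved multicolorings\<close>

text \<open>The color \<open>c\<^sub>i\<^sup>s\<close> is written \<open>c i s\<close>; only the values for \<open>i \<in> N\<close> and
  \<open>1 \<le> s \<le> k\<close> are relevant.\<close>

definition node_colors :: "nat \<Rightarrow> ('a \<Rightarrow> nat \<Rightarrow> nat) \<Rightarrow> 'a \<Rightarrow> nat set" where
  "node_colors k c i = c i ` {1..k}"

definition tuple_coloring :: "'a set \<Rightarrow> 'a set set \<Rightarrow> nat \<Rightarrow> ('a \<Rightarrow> nat \<Rightarrow> nat) \<Rightarrow> bool" where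
  "tuple_coloring N E k c \<longleftrightarrow>
     (\<forall>i\<in>N. inj_on (c i) {1..k}) \<and>
     (\<forall>i j. {i, j} \<in> E \<longrightarrow> node_colors k c i \<inter> node_colors k c j = {})"

text \<open>The chain \<open>c i 1 < c j 1 < c i 2 < c j 2 < \<dots> < c i k < c j k\<close>.\<close>

definition alternates :: "nat \<Rightarrow> ('a \<Rightarrow> nat \<Rightarrow> nat) \<Rightarrow> 'a \<Rightarrow> 'a \<Rightarrow> bool" where
  "alternates k c i j \<longleftrightarrow>
     (\<forall>s\<in>{1..k}. c i s < c j s) \<and> (\<forall>s\<in>{1..<k}. c j s < c i (s + 1))"

definition interleaved_coloring :: "'a set \<Rightarrow> 'a set set \<Rightarrow> nat \<Rightarrow> ('a \<Rightarrow> nat \<Rightarrow> nat) \<Rightarrow> bool" where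
  "interleaved_coloring N E k c \<longleftrightarrow>
     tuple_coloring N E k c \<and>
     (\<forall>i j. {i, j} \<in> E \<longrightarrow> alternates k c i j \<or> alternates k c j i)"

definition interleaved_chromatic :: "'a set \<Rightarrow> 'a set set \<Rightarrow> nat \<Rightarrow> nat" where
  "interleaved_chromatic N E k =
     (LEAST t. \<exists>c. interleaved_coloring N E k c \<and> t = card (\<Union>i\<in>N. node_colors k c i))"

definition interleaved_multichromatic :: "'a set \<Rightarrow> 'a set set \<Rightarrow> real" where
  "interleaved_multichromatic N E =
     (INF k\<in>{1..}. real (interleaved_chromatic N E k) / real k)"

subsection \<open>Acyclic orientations\<close>

text \<open>An orientation is the set of its arcs; \<open>(i, j) \<in> \<omega>\<close> means that the edge \<open>{i, j}\<close>
  is directed from \<open>i\<close> to \<open>j\<close>.\<close>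

definition orientation :: "'a set set \<Rightarrow> ('a \<times> 'a) set \<Rightarrow> bool" where
  "orientation E \<omega> \<longleftrightarrow>
     (\<forall>(i, j)\<in>\<omega>. {i, j} \<in> E) \<and>
     (\<forall>i j. {i, j} \<in> E \<longrightarrow> ((i, j) \<in> \<omega>) \<noteq> ((j, i) \<in> \<omega>))"

definition acyclic_orientations :: "'a set set \<Rightarrow> ('a \<times> 'a) set set" where
  "acyclic_orientations E = {\<omega>. orientation E \<omega> \<and> acyclic \<omega>}"

subsection \<open>Simple cycles\<close>

text \<open>A simple cycle is given by the list of its pairwise distinct nodes in one of its
  traversals, \<open>[v\<^sub>1, \<dots>, v\<^sub>n]\<close> standing for \<open>v\<^sub>1 \<rightarrow> v\<^sub>2 \<rightarrow> \<dots> \<rightarrow> v\<^sub>n \<rightarrow> v\<^sub>1\<close>.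
  The two traversal directions are then \<open>\<kappa>\<close> and \<open>rev \<kappa>\<close>, and the number of edges is
  \<open>length \<kappa>\<close>. A cycle is represented by several lists (choice of starting node and of
  direction), which all have the same length and, up to exchanging the two directions,
  the same values of \<open>forward_edges\<close>.\<close>

definition traversal_arcs :: "'a list \<Rightarrow> ('a \<times> 'a) set" where
  "traversal_arcs \<kappa> = set (zip \<kappa> (rotate1 \<kappa>))"

definition simple_cycles :: "'a set set \<Rightarrow> 'a list set" where
  "simple_cycles E =
     {\<kappa>. 3 \<le> length \<kappa> \<and> distinct \<kappa> \<and> (\<forall>(i, j)\<in>traversal_arcs \<kappa>. {i, j} \<in> E)}"

definition forward_edges :: "'a list \<Rightarrow> ('a \<times> 'a) set \<Rightarrow> nat" where
  "forward_edges \<kappa> \<omega> = card (traversal_arcs \<kappa> \<inter> \<omega>)"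

definition cycle_ratio :: "'a list \<Rightarrow> ('a \<times> 'a) set \<Rightarrow> real" where
  "cycle_ratio \<kappa> \<omega> =
     real (length \<kappa>) / real (min (forward_edges \<kappa> \<omega>) (forward_edges (rev \<kappa>) \<omega>))"

subsection \<open>The minima and maxima are taken over finite nonempty sets\<close>

lemma edge_nodes:
  assumes "finite_simple_graph N E" "{i, j} \<in> E"
  shows "i \<in> N" "j \<in> N" "i \<noteq> j"
proof -
  have "{i, j} \<subseteq> N" and c: "card {i, j} = 2"
    using assms by (auto simp: finite_simple_graph_def)
  then show "i \<in> N" "j \<in> N" by auto
  show "i \<noteq> j" using c by auto
qed

lemma finite_simple_cycles:
  assumes "finite_simple_graph N E"
  shows "finite (simple_cycles E)"
proof (rule finite_subset)
  show "simple_cycles E \<subseteq> {\<kappa>. set \<kappa> \<subseteq> N \<and> length \<kappa> \<le> card N}"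
  proof clarify
    fix \<kappa> assume k: "\<kappa> \<in> simple_cycles E"
    have sub: "set \<kappa> \<subseteq> N"
    proof
      fix x assume "x \<in> set \<kappa>"
      then obtain y where "(x, y) \<in> traversal_arcs \<kappa>"
        unfolding traversal_arcs_def
        by (metis (no_types) in_set_impl_in_set_zip1 length_rotate1)
      then have "{x, y} \<in> E" using k by (auto simp: simple_cycles_def)
      then show "x \<in> N" using edge_nodes[OF assms] by blast
    qed
    moreover have "length \<kappa> \<le> card N"
      using k sub assms
      by (metis (mono_tags, lifting) card_mono distinct_card finite_simple_graph_def
          mem_Collect_eq simple_cycles_def)
    ultimately show "set \<kappa> \<subseteq> N \<and> length \<kappa> \<le> card N" by blast
  qed
  show "finite {\<kappa>. set \<kappa> \<subseteq> N \<and> length \<kappa> \<le> card N}"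
    using assms by (intro finite_lists_length_le) (simp add: finite_simple_graph_def)
qed

lemma finite_acyclic_orientations:
  assumes "finite_simple_graph N E"
  shows "finite (acyclic_orientations E)"
proof (rule finite_subset)
  show "acyclic_orientations E \<subseteq> Pow (N \<times> N)"
    using edge_nodes[OF assms] by (fastforce simp: acyclic_orientations_def orientation_def)
  show "finite (Pow (N \<times> N))"
    using assms by (simp add: finite_simple_graph_def)
qed

lemma acyclic_orientations_nonempty:
  assumes "finite_simple_graph N E"
  shows "acyclic_orientations E \<noteq> {}"
proof -
  have "finite N" using assms by (simp add: finite_simple_graph_def)
  then obtain f :: "'a \<Rightarrow> nat" where f: "inj_on f N"
    using finite_imp_inj_to_nat_seg by blast
  define \<omega> where "\<omega> = {(i, j). {i, j} \<in> E \<and> f i < f j}"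
  have "orientation E \<omega>"
  proof -
    have "f i \<noteq> f j" if "{i, j} \<in> E" for i j
      using edge_nodes[OF assms that] f by (auto dest: inj_onD)
    then show ?thesis
      by (auto simp: orientation_def \<omega>_def insert_commute not_less_iff_gr_or_eq)
  qed
  moreover have "acyclic \<omega>"
    by (rule wf_acyclic, rule wf_subset[OF wf_measure[of f]]) (auto simp: \<omega>_def)
  ultimately show ?thesis by (auto simp: acyclic_orientations_def)
qed

lemma interleaved_coloring_exists:
  assumes "finite_simple_graph N E"
  shows "\<exists>c. interleaved_coloring N E k c"
proof -
  have "finite N" using assms by (simp add: finite_simple_graph_def)
  then obtain f :: "'a \<Rightarrow> nat" and n where f: "inj_on f N" and n: "f ` N = {i. i < n}"
    using finite_imp_inj_to_nat_seg by metis
  define c where "c i s = s * n + f i" for i s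
  have lt: "f i < n" if "i \<in> N" for i using n that by blast
  have alt: "alternates k c i j" if "i \<in> N" "j \<in> N" "f i < f j" for i j
    using lt[OF that(2)] that(3) by (auto simp: alternates_def c_def)
  have ne: "c i s \<noteq> c j t" if "i \<in> N" "j \<in> N" "i \<noteq> j" for i j s t
  proof
    assume "c i s = c j t"
    then have "(s * n + f i) mod n = (t * n + f j) mod n" by (simp add: c_def)
    then have "f i = f j" using lt that by simp
    then show False using f that by (auto dest: inj_onD)
  qed
  have "tuple_coloring N E k c"
  proof -
    have "inj_on (c i) {1..k}" if "i \<in> N" for i
      using lt[OF that] by (auto simp: inj_on_def c_def)
    moreover have "node_colors k c i \<inter> node_colors k c j = {}" if "{i, j} \<in> E" for i j
      using ne[OF edge_nodes[OF assms that]] by (auto simp: node_colors_def)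
    ultimately show ?thesis by (auto simp: tuple_coloring_def)
  qed
  moreover have "alternates k c i j \<or> alternates k c j i" if "{i, j} \<in> E" for i j
    using edge_nodes[OF assms that] alt f by (metis inj_onD linorder_neqE_nat)
  ultimately show ?thesis by (auto simp: interleaved_coloring_def)
qed

end

theory Submission
  imports Defs
begin

text \<open>
  Stretch a coloring out in time: repeat an interleaved \<open>k\<close>-tuple coloring with \<open>t\<close> colors
  with period \<open>t\<close>. Node \<open>v\<close> then receives an infinite sequence of colors \<open>f v 0, f v 1, \<dots>\<close>
  with \<open>f v (n + k) = f v n + t\<close>, and the sequences of two neighbours alternate for ever. Orient
  each edge towards the node that comes second. Crossing an edge forwards keeps the index \<open>n\<close>,
  crossing it backwards increases \<open>n\<close> by one, and each crossing increases the color by at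
  least one. Hence one turn around a cycle \<open>\<kappa>\<close> with \<open>m\<close> backward edges costs \<open>m\<close> indices and
  gains at least \<open>|\<kappa>|\<close>, and \<open>k\<close> turns give \<open>k * |\<kappa>| \<le> t * m\<close>
  (\<open>closed_walk_gain\<close>). Applied to both traversals of every cycle, this bounds \<open>t / k\<close> below by
  the largest cycle ratio of the orientation (\<open>interleaved_chromatic_lower\<close>). A single edge
  already needs \<open>2 * k\<close> colors, which is the lower bound for forests.

  Conversely, fix an acyclic orientation and let \<open>T \<ge> 2\<close> be at least all of its cycle ratios.
  A periodic schedule in which \<open>v\<close> is served at the real times \<open>x v + s * T\<close>, with neighbours
  alternating at distance at least one, is a solution of the difference constraints
  \<open>x a + 1 \<le> x b\<close> and \<open>x b + 1 \<le> x a + T\<close> for the arcs \<open>(a, b)\<close>. Such a system is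
  solvable when no simple closed walk has positive weight (\<open>potential_exists\<close>); here a simple cycle has
  weight \<open>|\<kappa>| - T * m\<close> and an edge traversed back and forth has weight \<open>2 - T\<close>, so the
  hypothesis on \<open>T\<close> is exactly what is needed (\<open>schedule_exists\<close>). Times at distance at least
  one have different integer parts in the same order, so rounding down the first \<open>k\<close> times gives
  an interleaved \<open>k\<close>-tuple coloring with at most \<open>k * T + O(1)\<close> colors. Letting \<open>k\<close> grow bounds
  the infimum by \<open>T\<close> (\<open>interleaved_multichromatic_upper\<close>).
\<close>

section \<open>Weights of walks\<close>

fun walk_sum :: "('a \<Rightarrow> 'a \<Rightarrow> 'b::comm_monoid_add) \<Rightarrow> 'a list \<Rightarrow> 'b" where
  "walk_sum w (x # y # zs) = w x y + walk_sum w (y # zs)"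
| "walk_sum w _ = 0"

lemma walk_sum_append:
  "walk_sum w (xs @ y # zs) = walk_sum w (xs @ [y]) + walk_sum w (y # zs)"
proof (induction xs)
  case (Cons x xs)
  then show ?case by (cases xs) (auto simp: add.assoc)
qed simp

lemma walk_sum_zip:
  "walk_sum w (x # xs @ [y]) = sum_list (map (\<lambda>(a, b). w a b) (zip (x # xs) (xs @ [y])))"
  by (induction xs arbitrary: x) auto

lemma successively_zip:
  "successively P (x # xs @ [y]) \<longleftrightarrow> (\<forall>(a, b) \<in> set (zip (x # xs) (xs @ [y])). P a b)"
  by (induction xs arbitrary: x) auto

lemma traversal_arcs_Cons: "traversal_arcs (x # xs) = set (zip (x # xs) (xs @ [x]))"
  by (simp add: traversal_arcs_def)

lemma closed_walk_iff_traversal_arcs: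
  assumes "\<kappa> \<noteq> []"
  shows "successively P (\<kappa> @ [hd \<kappa>]) \<longleftrightarrow> (\<forall>(a, b) \<in> traversal_arcs \<kappa>. P a b)"
  using assms successively_zip[of P "hd \<kappa>" "tl \<kappa>" "hd \<kappa>"]
  by (cases \<kappa>) (auto simp: traversal_arcs_Cons)

lemma closed_walk_sum:
  assumes "distinct \<kappa>" "\<kappa> \<noteq> []"
  shows "walk_sum w (\<kappa> @ [hd \<kappa>]) = (\<Sum>(a, b) \<in> traversal_arcs \<kappa>. w a b)"
proof -
  obtain x xs where k: "\<kappa> = x # xs" using assms(2) by (cases \<kappa>) auto
  have "distinct (zip (x # xs) (xs @ [x]))"
    using assms(1) k by (intro distinct_zipI1) simp
  then show ?thesis
    using walk_sum_zip[of w x xs x]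
    by (simp only: k traversal_arcs_Cons list.sel append_Cons sum_list_distinct_conv_sum_set)
qed

lemma finite_traversal_arcs: "finite (traversal_arcs \<kappa>)"
  by (simp add: traversal_arcs_def)

text \<open>Rotating a traversal only rotates its list of arcs; this is what makes the reversed
  traversal, whose list of arcs starts elsewhere, have exactly the converse arcs.\<close>

lemma traversal_arcs_rotate1: "traversal_arcs (rotate1 xs) = traversal_arcs xs"
proof (cases xs)
  case (Cons x ys)
  show ?thesis
  proof (cases ys)
    case (Cons y zs)
    then show ?thesis
      using zip_append[of "y # zs" "zs @ [x]" "[x]" "[y]"] \<open>xs = x # ys\<close>
      by (simp add: traversal_arcs_def)
  qed (simp add: traversal_arcs_def \<open>xs = x # ys\<close>)
qed (simp add: traversal_arcs_def)

lemma traversal_arcs_rev: "traversal_arcs (rev \<kappa>) = (traversal_arcs \<kappa>)\<inverse>"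
proof -
  have rot: "rotate1 (rev (rotate1 \<kappa>)) = rev \<kappa>" by (cases \<kappa>) auto
  have "traversal_arcs (rev \<kappa>) = traversal_arcs (rev (rotate1 \<kappa>))"
    using traversal_arcs_rotate1[of "rev (rotate1 \<kappa>)"] rot by simp
  also have "\<dots> = set (rev (zip (rotate1 \<kappa>) \<kappa>))"
    by (simp add: traversal_arcs_def rot zip_rev del: set_rev)
  also have "\<dots> = (traversal_arcs \<kappa>)\<inverse>"
    by (auto simp: traversal_arcs_def set_zip)
  finally show ?thesis .
qed

section \<open>Orientations along a cycle\<close>

definition backward :: "('a \<times> 'a) set \<Rightarrow> 'a \<Rightarrow> 'a \<Rightarrow> nat" where
  "backward \<omega> a b = (if (a, b) \<in> \<omega> then 0 else 1)"

lemma simple_cycles_rev: "\<kappa> \<in> simple_cycles E \<Longrightarrow> rev \<kappa> \<in> simple_cycles E"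
  by (auto simp: simple_cycles_def traversal_arcs_rev insert_commute)

lemma simple_cycle_edges:
  assumes "\<kappa> \<in> simple_cycles E"
  shows "successively (\<lambda>a b. {a, b} \<in> E) (\<kappa> @ [hd \<kappa>])"
  using assms by (subst closed_walk_iff_traversal_arcs) (auto simp: simple_cycles_def)

text \<open>The edges that one traversal crosses backwards are those that the other crosses forwards,
  so the number of backward steps of a cycle, a sum along a walk, is \<open>forward_edges\<close> of the
  reverse.\<close>

lemma backward_sum_cycle:
  assumes "orientation E \<omega>" and "\<kappa> \<in> simple_cycles E"
  shows "walk_sum (backward \<omega>) (\<kappa> @ [hd \<kappa>]) = forward_edges (rev \<kappa>) \<omega>"
proof -
  let ?A = "traversal_arcs \<kappa>"
  note fin = finite_traversal_arcs[of \<kappa>]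
  have flip: "(a, b) \<notin> \<omega> \<longleftrightarrow> (b, a) \<in> \<omega>" if "(a, b) \<in> ?A" for a b
    using assms that by (auto simp: orientation_def simple_cycles_def)
  have "walk_sum (backward \<omega>) (\<kappa> @ [hd \<kappa>]) = (\<Sum>p \<in> ?A. if p \<notin> \<omega> then 1 else 0)"
    using assms(2) by (subst closed_walk_sum)
      (auto simp: simple_cycles_def backward_def intro!: sum.cong)
  also have "\<dots> = card {p \<in> ?A. p \<notin> \<omega>}"
    using fin by (simp add: sum.If_cases Int_def)
  also have "{p \<in> ?A. p \<notin> \<omega>} = (?A\<inverse> \<inter> \<omega>)\<inverse>"
    using flip by auto
  also have "card ((?A\<inverse> \<inter> \<omega>)\<inverse>) = card (?A\<inverse> \<inter> \<omega>)" by simp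
  finally show ?thesis by (simp add: forward_edges_def traversal_arcs_rev)
qed

lemma forward_edges_add_rev:
  assumes "orientation E \<omega>" and k: "\<kappa> \<in> simple_cycles E"
  shows "forward_edges \<kappa> \<omega> + forward_edges (rev \<kappa>) \<omega> = length \<kappa>"
proof -
  let ?A = "traversal_arcs \<kappa>"
  note fin = finite_traversal_arcs[of \<kappa>]
  have d: "distinct \<kappa>" and ne: "\<kappa> \<noteq> []" using k by (auto simp: simple_cycles_def)
  have "forward_edges (rev \<kappa>) \<omega> = (\<Sum>p \<in> ?A. if p \<in> \<omega> then 0 else 1)"
    using backward_sum_cycle[OF assms] closed_walk_sum[OF d ne, of "backward \<omega>"]
    by (simp add: backward_def split_def)
  moreover have "forward_edges \<kappa> \<omega> = (\<Sum>p \<in> ?A. if p \<in> \<omega> then 1 else 0)"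
    using fin by (simp add: forward_edges_def sum.If_cases)
  moreover have "(\<Sum>p \<in> ?A. if p \<in> \<omega> then 1 else 0) + (\<Sum>p \<in> ?A. if p \<in> \<omega> then 0 else 1)
      = (\<Sum>p \<in> ?A. 1 :: nat)"
    by (subst sum.distrib[symmetric], rule sum.cong) auto
  ultimately have "forward_edges \<kappa> \<omega> + forward_edges (rev \<kappa>) \<omega> = (\<Sum>p \<in> ?A. 1)"
    by simp
  also have "\<dots> = length \<kappa>"
    using d by (simp add: traversal_arcs_def distinct_zipI1 distinct_card)
  finally show ?thesis .
qed

lemma successively_trancl:
  "successively (\<lambda>a b. (a, b) \<in> r) (x # xs @ [y]) \<Longrightarrow> (x, y) \<in> r\<^sup>+"
  by (induction xs arbitrary: x) (auto intro: trancl_into_trancl2)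

text \<open>A cycle crossed forwards throughout would be a directed cycle of the orientation.\<close>

lemma forward_edges_rev_pos:
  assumes "\<omega> \<in> acyclic_orientations E" and k: "\<kappa> \<in> simple_cycles E"
  shows "forward_edges (rev \<kappa>) \<omega> > 0"
proof (rule ccontr)
  assume "\<not> forward_edges (rev \<kappa>) \<omega> > 0"
  then have none: "(traversal_arcs \<kappa>)\<inverse> \<inter> \<omega> = {}"
    using finite_traversal_arcs[of "rev \<kappa>"]
    by (simp add: forward_edges_def traversal_arcs_rev)
  have ne: "\<kappa> \<noteq> []" using k by (auto simp: simple_cycles_def)
  have "(a, b) \<in> \<omega>" if ab: "(a, b) \<in> traversal_arcs \<kappa>" for a b
  proof -
    have "{a, b} \<in> E" using k ab by (auto simp: simple_cycles_def)
    moreover have "(b, a) \<notin> \<omega>" using none ab by auto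
    ultimately show ?thesis
      using assms(1) by (auto simp: acyclic_orientations_def orientation_def)
  qed
  then have "successively (\<lambda>a b. (a, b) \<in> \<omega>) (\<kappa> @ [hd \<kappa>])"
    using ne by (subst closed_walk_iff_traversal_arcs) auto
  then have "(hd \<kappa>, hd \<kappa>) \<in> \<omega>\<^sup>+"
    using successively_trancl[of \<omega> "hd \<kappa>" "tl \<kappa>" "hd \<kappa>"] ne by (cases \<kappa>) auto
  then show False using assms(1) by (auto simp: acyclic_orientations_def acyclic_def)
qed

lemma min_forward_edges_pos:
  assumes "\<omega> \<in> acyclic_orientations E" and "\<kappa> \<in> simple_cycles E"
  shows "min (forward_edges \<kappa> \<omega>) (forward_edges (rev \<kappa>) \<omega>) > 0"
  using forward_edges_rev_pos[OF assms]
    forward_edges_rev_pos[OF assms(1) simple_cycles_rev[OF assms(2)]] by simp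

text \<open>The rarer direction accounts for at most half of the edges.\<close>

lemma cycle_ratio_ge_2:
  assumes "\<omega> \<in> acyclic_orientations E" and "\<kappa> \<in> simple_cycles E"
  shows "cycle_ratio \<kappa> \<omega> \<ge> 2"
proof -
  let ?m = "min (forward_edges \<kappa> \<omega>) (forward_edges (rev \<kappa>) \<omega>)"
  have "2 * ?m \<le> length \<kappa>"
    using forward_edges_add_rev[of E \<omega> \<kappa>] assms by (simp add: acyclic_orientations_def)
  then have "2 * real ?m \<le> real (length \<kappa>)" by linarith
  moreover have "real ?m > 0" using min_forward_edges_pos[OF assms] by linarith
  ultimately show ?thesis unfolding cycle_ratio_def by (simp add: pos_le_divide_eq del: of_nat_min)
qed

section \<open>Potentials\<close>

text \<open>Take for \<open>x v\<close> the largest weight of a simple path ending at \<open>v\<close>; the trivial path makes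
  it nonnegative. Prolonging an optimal path to \<open>a\<close> by an arc \<open>(a, b)\<close> gives the constraint at
  once if the path avoids \<open>b\<close>; otherwise the prolonged path closes a simple cycle at \<open>b\<close>, and
  cutting it off, which loses no weight, leaves a simple path to \<open>b\<close>.\<close>

lemma potential_exists:
  fixes w :: "'a \<Rightarrow> 'a \<Rightarrow> real" and A :: "('a \<times> 'a) set"
  assumes fin: "finite N" and arcs: "A \<subseteq> N \<times> N"
    and cyc: "\<And>\<kappa>. \<kappa> \<noteq> [] \<Longrightarrow> distinct \<kappa> \<Longrightarrow>
        successively (\<lambda>a b. (a, b) \<in> A) (\<kappa> @ [hd \<kappa>]) \<Longrightarrow> walk_sum w (\<kappa> @ [hd \<kappa>]) \<le> 0"
  shows "\<exists>x. (\<forall>v. x v \<ge> 0) \<and> (\<forall>(a, b) \<in> A. x a + w a b \<le> x b)"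
proof -
  \<comment> \<open>A path is stored without its last node \<open>v\<close>.\<close>
  define paths where "paths v =
    {p. distinct (p @ [v]) \<and> set p \<subseteq> N \<and> successively (\<lambda>a b. (a, b) \<in> A) (p @ [v])}" for v
  define x where "x v = Max ((\<lambda>p. walk_sum w (p @ [v])) ` paths v)" for v
  have "paths v \<subseteq> {p. set p \<subseteq> N \<and> length p \<le> card N}" for v
    using fin by (auto simp: paths_def) (metis card_mono distinct_card)
  then have finp: "finite (paths v)" for v
    by (rule finite_subset) (rule finite_lists_length_le[OF fin])
  have triv: "[] \<in> paths v" for v by (simp add: paths_def)
  have le: "walk_sum w (p @ [v]) \<le> x v" if "p \<in> paths v" for p v
    unfolding x_def using finp that by (intro Max_ge) auto
  have "x v \<ge> 0" for v using le[OF triv, of v] by simp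
  moreover have "x a + w a b \<le> x b" if ab: "(a, b) \<in> A" for a b
  proof -
    have "x a \<in> (\<lambda>p. walk_sum w (p @ [a])) ` paths a"
      unfolding x_def using finp triv by (intro Max_in) auto
    then obtain p where p: "p \<in> paths a" and xa: "x a = walk_sum w (p @ [a])" by auto
    have ext: "x a + w a b = walk_sum w (p @ [a, b])"
      using walk_sum_append[of w p a "[b]"] xa by simp
    have walk: "successively (\<lambda>a b. (a, b) \<in> A) (p @ [a, b])"
      using p ab by (auto simp: paths_def successively_append_iff)
    show ?thesis
    proof (cases "b \<in> set (p @ [a])")
      case False
      then have "p @ [a] \<in> paths b"
        using p walk ab arcs by (auto simp: paths_def)
      then show ?thesis using le ext by fastforce
    next
      case True
      then obtain q r where qr: "p @ [a] = q @ b # r" by (meson split_list)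
      then have pab: "p @ [a, b] = q @ (b # r) @ [b]"
        by (metis append.assoc append_Cons append_Nil)
      have "distinct (p @ [a])" using p by (simp add: paths_def)
      then have dist: "distinct (q @ b # r)" unfolding qr .
      have "successively (\<lambda>a b. (a, b) \<in> A) ((b # r) @ [hd (b # r)])"
        using walk unfolding pab by (simp add: successively_append_iff)
      then have "walk_sum w ((b # r) @ [hd (b # r)]) \<le> 0" using dist by (intro cyc) auto
      then have neg: "walk_sum w (b # r @ [b]) \<le> 0" by simp
      have "q \<in> paths b"
      proof -
        have "set q \<subseteq> set (p @ [a])" using qr by auto
        moreover have "set (p @ [a]) \<subseteq> N" using p ab arcs by (auto simp: paths_def)
        moreover have "successively (\<lambda>a b. (a, b) \<in> A) (q @ [b])"
          using walk unfolding pab by (auto simp: successively_append_iff)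
        ultimately show ?thesis using dist by (auto simp: paths_def)
      qed
      from le[OF this] neg ext show ?thesis
        unfolding pab using walk_sum_append[of w q b "r @ [b]"] by simp
    qed
  qed
  ultimately show ?thesis by blast
qed

lemma walk_sum_one_minus:
  "walk_sum (\<lambda>a b. 1 - T * real (d a b)) (x # xs) = real (length xs) - T * real (walk_sum d (x # xs))"
  by (induction xs arbitrary: x) (auto simp: algebra_simps)

text \<open>The two constraints of an arc are the arcs in both directions of one weighted digraph, with
  weight \<open>1\<close> forwards and \<open>1 - T\<close> backwards. Its simple closed walks are the simple cycles of the
  graph and, in addition, the edges traversed back and forth; the latter need \<open>T \<ge> 2\<close>.\<close>

lemma schedule_exists:
  fixes T :: real
  assumes G: "finite_simple_graph N E" and \<omega>: "\<omega> \<in> acyclic_orientations E"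
    and T: "T \<ge> 2" "\<And>\<kappa>. \<kappa> \<in> simple_cycles E \<Longrightarrow> cycle_ratio \<kappa> \<omega> \<le> T"
  obtains x where "\<And>v. x v \<ge> 0"
    and "\<And>a b. (a, b) \<in> \<omega> \<Longrightarrow> x a + 1 \<le> x b \<and> x b + 1 \<le> x a + T"
proof -
  have or: "orientation E \<omega>" using \<omega> by (simp add: acyclic_orientations_def)
  define A where "A = {(a, b). {a, b} \<in> E}"
  define w where "w a b = 1 - T * real (backward \<omega> a b)" for a b
  have "\<exists>x. (\<forall>v. x v \<ge> 0) \<and> (\<forall>(a, b) \<in> A. x a + w a b \<le> x b)"
  proof (rule potential_exists)
    show "finite N" using G by (simp add: finite_simple_graph_def)
    show "A \<subseteq> N \<times> N" using edge_nodes[OF G] by (auto simp: A_def)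
    fix \<kappa> assume ne: "\<kappa> \<noteq> []" and d: "distinct \<kappa>"
      and s: "successively (\<lambda>a b. (a, b) \<in> A) (\<kappa> @ [hd \<kappa>])"
    have w: "walk_sum w (\<kappa> @ [hd \<kappa>])
        = real (length \<kappa>) - T * real (walk_sum (backward \<omega>) (\<kappa> @ [hd \<kappa>]))"
      using walk_sum_one_minus[of T "backward \<omega>" "hd \<kappa>" "tl \<kappa> @ [hd \<kappa>]"] ne
      by (cases \<kappa>) (auto simp: w_def[abs_def])
    consider a where "\<kappa> = [a]" | a b where "\<kappa> = [a, b]" | "length \<kappa> \<ge> 3"
      using ne by (cases \<kappa>; cases "tl \<kappa>"; cases "tl (tl \<kappa>)") auto
    then show "walk_sum w (\<kappa> @ [hd \<kappa>]) \<le> 0"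
    proof cases
      case 1
      then show ?thesis using s edge_nodes(3)[OF G, of a a] by (auto simp: A_def)
    next
      case 2
      then have "{a, b} \<in> E" using s by (simp add: A_def)
      then have "backward \<omega> a b + backward \<omega> b a = 1"
        using or by (auto simp: orientation_def backward_def)
      then show ?thesis using w T(1) 2 by simp
    next
      case 3
      then have k: "\<kappa> \<in> simple_cycles E"
        using s d closed_walk_iff_traversal_arcs[OF ne, of "\<lambda>a b. (a, b) \<in> A"]
        by (auto simp: simple_cycles_def A_def)
      let ?m = "min (forward_edges \<kappa> \<omega>) (forward_edges (rev \<kappa>) \<omega>)"
      have "real ?m > 0" using min_forward_edges_pos[OF \<omega> k] by linarith
      then have "real (length \<kappa>) \<le> T * real ?m"
        using T(2)[OF k] unfolding cycle_ratio_def by (simp add: pos_divide_le_eq del: of_nat_min)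
      also have "\<dots> \<le> T * real (forward_edges (rev \<kappa>) \<omega>)"
        using T(1) by (intro mult_left_mono) auto
      finally show ?thesis using w backward_sum_cycle[OF or k] by simp
    qed
  qed
  then obtain x where x: "\<And>v. x v \<ge> 0" "\<And>a b. (a, b) \<in> A \<Longrightarrow> x a + w a b \<le> x b" by blast
  show ?thesis
  proof (rule that)
    show "x v \<ge> 0" for v by (rule x(1))
    fix a b assume ab: "(a, b) \<in> \<omega>"
    then have "{a, b} \<in> E" "(b, a) \<notin> \<omega>" using or by (auto simp: orientation_def)
    then show "x a + 1 \<le> x b \<and> x b + 1 \<le> x a + T"
      using x(2)[of a b] x(2)[of b a] ab by (auto simp: A_def w_def backward_def insert_commute)
  qed
qed

section \<open>Colorings from orientations\<close>

lemma finite_node_colors: "finite (node_colors k c i)"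
  by (simp add: node_colors_def)

text \<open>Alternation compares only colors of equal or adjacent index; monotonicity extends the
  comparison to all pairs of indices.\<close>

lemma alternates_disjoint:
  assumes alt: "alternates k c i j" and mono: "mono (c i)" "mono (c j)"
  shows "node_colors k c i \<inter> node_colors k c j = {}"
proof -
  have "c i s \<noteq> c j t" if s: "s \<in> {1..k}" and t: "t \<in> {1..k}" for s t
  proof (cases "s \<le> t")
    case True
    have "c i s < c j s" using alt s by (simp add: alternates_def)
    also have "\<dots> \<le> c j t" using mono(2) True by (rule monoD)
    finally show ?thesis by simp
  next
    case False
    have "c j t < c i (t + 1)" using alt s t False by (auto simp: alternates_def)
    also have "\<dots> \<le> c i s" using False by (intro monoD[OF mono(1)]) auto
    finally show ?thesis by simp
  qed
  then show ?thesis by (auto simp: node_colors_def)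
qed

lemma nat_floor_less:
  fixes y z :: real
  assumes "0 \<le> y" "y + 1 \<le> z"
  shows "nat \<lfloor>y\<rfloor> < nat \<lfloor>z\<rfloor>"
  using assms by linarith

lemma interleaved_chromatic_le:
  "interleaved_coloring N E k c \<Longrightarrow>
    interleaved_chromatic N E k \<le> card (\<Union>i\<in>N. node_colors k c i)"
  unfolding interleaved_chromatic_def by (rule Least_le) blast

lemma interleaved_chromatic_attained:
  assumes "finite_simple_graph N E"
  obtains c where "interleaved_coloring N E k c"
    and "interleaved_chromatic N E k = card (\<Union>i\<in>N. node_colors k c i)"
proof -
  have "\<exists>t c. interleaved_coloring N E k c \<and> t = card (\<Union>i\<in>N. node_colors k c i)"
    using interleaved_coloring_exists[OF assms] by blast
  from LeastI_ex[OF this] that show ?thesis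
    unfolding interleaved_chromatic_def by blast
qed

lemma interleaved_multichromatic_le:
  assumes "k \<ge> 1"
  shows "interleaved_multichromatic N E \<le> real (interleaved_chromatic N E k) / real k"
  unfolding interleaved_multichromatic_def using assms
  by (intro cINF_lower bdd_belowI[of _ 0]) auto

text \<open>All rounded times lie between \<open>0\<close> and \<open>X + k * T\<close>, which bounds the number of colors.\<close>

lemma interleaved_chromatic_schedule:
  fixes T :: real
  assumes G: "finite_simple_graph N E" and or: "orientation E \<omega>" and T: "T \<ge> 1"
    and x: "\<And>v. x v \<ge> 0" "\<And>v. v \<in> N \<Longrightarrow> x v \<le> X"
      "\<And>a b. (a, b) \<in> \<omega> \<Longrightarrow> x a + 1 \<le> x b \<and> x b + 1 \<le> x a + T"
    and X: "X \<ge> 0"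
  shows "real (interleaved_chromatic N E k) \<le> X + real k * T + 1"
proof -
  define c where "c v s = nat \<lfloor>x v + real s * T\<rfloor>" for v and s :: nat
  have ge: "0 \<le> x v + real s * T" for v s using x(1)[of v] T by simp
  have "c v s < c v (Suc s)" for v s
    unfolding c_def using ge T by (intro nat_floor_less) (auto simp: algebra_simps)
  then have sm: "strict_mono (c v)" for v by (simp add: strict_mono_Suc_iff)
  have alt: "alternates k c a b" if "(a, b) \<in> \<omega>" for a b
    unfolding alternates_def c_def using x(3)[OF that] ge
    by (intro conjI ballI nat_floor_less) (auto simp: algebra_simps)
  have edge: "(i, j) \<in> \<omega> \<or> (j, i) \<in> \<omega>" if "{i, j} \<in> E" for i j
    using or that by (auto simp: orientation_def)
  have "interleaved_coloring N E k c"
    unfolding interleaved_coloring_def tuple_coloring_def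
  proof (intro conjI allI impI ballI)
    show "inj_on (c i) {1..k}" for i
      using strict_mono_imp_inj_on[OF sm, of i] by (auto simp: inj_on_def)
  next
    fix i j assume "{i, j} \<in> E"
    then have alts: "alternates k c i j \<or> alternates k c j i" using edge alt by blast
    then show "alternates k c i j \<or> alternates k c j i" .
    from alts show "node_colors k c i \<inter> node_colors k c j = {}"
      using alternates_disjoint sm strict_mono_mono by (metis Int_commute)
  qed
  then have "interleaved_chromatic N E k \<le> card (\<Union>i\<in>N. node_colors k c i)"
    by (rule interleaved_chromatic_le)
  also have "\<dots> \<le> card {..nat \<lfloor>X + real k * T\<rfloor>}"
  proof (rule card_mono)
    have "x i + real s * T \<le> X + real k * T" if "i \<in> N" "s \<le> k" for i s
      using that x(2) T by (intro add_mono mult_right_mono) auto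
    then show "(\<Union>i\<in>N. node_colors k c i) \<subseteq> {..nat \<lfloor>X + real k * T\<rfloor>}"
      by (auto simp: node_colors_def c_def intro!: nat_mono floor_mono)
  qed simp
  finally have "real (interleaved_chromatic N E k) \<le> real (nat \<lfloor>X + real k * T\<rfloor>) + 1" by simp
  also have "real (nat \<lfloor>X + real k * T\<rfloor>) \<le> X + real k * T"
    using X T by (intro of_nat_floor) auto
  finally show ?thesis by simp
qed

lemma interleaved_multichromatic_upper:
  fixes T :: real
  assumes G: "finite_simple_graph N E" and \<omega>: "\<omega> \<in> acyclic_orientations E"
    and T: "T \<ge> 2" "\<And>\<kappa>. \<kappa> \<in> simple_cycles E \<Longrightarrow> cycle_ratio \<kappa> \<omega> \<le> T"
  shows "interleaved_multichromatic N E \<le> T"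
proof -
  obtain x where x: "\<And>v. x v \<ge> 0"
    "\<And>a b. (a, b) \<in> \<omega> \<Longrightarrow> x a + 1 \<le> x b \<and> x b + 1 \<le> x a + T"
    using schedule_exists[OF G \<omega> T] by blast
  have fin: "finite N" using G by (simp add: finite_simple_graph_def)
  define X where "X = sum x N"
  have X: "X \<ge> 0" "\<And>v. v \<in> N \<Longrightarrow> x v \<le> X"
    unfolding X_def using x(1) fin by (auto intro: sum_nonneg member_le_sum)
  have bound: "interleaved_multichromatic N E \<le> T + (X + 1) / real k" if "k \<ge> 1" for k
  proof -
    have "real (interleaved_chromatic N E k) \<le> X + real k * T + 1"
      using \<omega> T(1) interleaved_chromatic_schedule[OF G _ _ x(1) X(2) x(2) X(1)]
      by (auto simp: acyclic_orientations_def)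
    then have "real (interleaved_chromatic N E k) / real k \<le> T + (X + 1) / real k"
      using that by (simp add: field_simps)
    then show ?thesis using interleaved_multichromatic_le[OF that, of N E] by linarith
  qed
  have "(\<lambda>k. T + (X + 1) / real k) \<longlonglongrightarrow> T + 0"
    by (intro tendsto_intros lim_const_over_n)
  then show ?thesis
    using bound by (intro LIMSEQ_le_const[of _ T]) auto
qed

section \<open>Orientations from colorings\<close>

text \<open>In the next two lemmas \<open>d a b\<close> is the cost in indices of the step from \<open>a\<close> to \<open>b\<close>, while
  the value of \<open>f\<close> grows by at least one with each step.\<close>

lemma walk_gain:
  fixes f :: "'a \<Rightarrow> nat \<Rightarrow> nat"
  assumes "successively (\<lambda>a b. \<forall>n. f a n + 1 \<le> f b (n + d a b)) (x # xs)"
  shows "f x n + length xs \<le> f (last (x # xs)) (n + walk_sum d (x # xs))"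
  using assms
proof (induction xs arbitrary: x n)
  case (Cons y ys)
  have "f x n + 1 \<le> f y (n + d x y)" using Cons.prems by simp
  moreover have "f y (n + d x y) + length ys
      \<le> f (last (y # ys)) (n + d x y + walk_sum d (y # ys))"
    using Cons.prems by (intro Cons.IH) simp
  ultimately show ?case by (simp add: add.assoc)
qed simp

text \<open>A single turn compares \<open>f\<close> at indices that need not differ by a multiple of the period
  \<open>k\<close>; after \<open>k\<close> turns they do, and periodicity evaluates the total growth exactly.\<close>

lemma closed_walk_gain:
  fixes f :: "'a \<Rightarrow> nat \<Rightarrow> nat"
  assumes ne: "\<kappa> \<noteq> []"
    and step: "successively (\<lambda>a b. \<forall>n. f a n + 1 \<le> f b (n + d a b)) (\<kappa> @ [hd \<kappa>])"
    and per: "\<And>v m. f v (m * k) = f v 0 + m * t"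
  shows "k * length \<kappa> \<le> t * walk_sum d (\<kappa> @ [hd \<kappa>])"
proof -
  define v where "v = hd \<kappa>"
  define D where "D = walk_sum d (\<kappa> @ [hd \<kappa>])"
  have turn: "f v n + length \<kappa> \<le> f v (n + D)" for n
    using walk_gain[of f d "hd \<kappa>" "tl \<kappa> @ [hd \<kappa>]" n] step ne
    by (cases \<kappa>) (auto simp: v_def D_def)
  have "f v 0 + m * length \<kappa> \<le> f v (m * D)" for m
  proof (induction m)
    case (Suc m)
    then show ?case using turn[of "m * D"] by (simp add: algebra_simps)
  qed simp
  from this[of k] per[of v D] show ?thesis by (simp add: D_def mult.commute)
qed

text \<open>Replacing each color by its rank among the \<open>t\<close> colors in use puts all values below \<open>t\<close>, so
  that translating by \<open>t\<close> starts a new round above everything in the previous one. This gives the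
  inequality that alternation does not contain: the last color of \<open>b\<close> in a round lies below the
  first color of \<open>a\<close> in the next. Indices \<open>n\<close> start at \<open>0\<close>, color indices at \<open>1\<close>.\<close>

lemma periodic_coloring:
  assumes G: "finite_simple_graph N E" and k: "k \<ge> 1"
    and col: "interleaved_coloring N E k c"
    and t: "t = card (\<Union>i\<in>N. node_colors k c i)"
  obtains f :: "'a \<Rightarrow> nat \<Rightarrow> nat"
  where "\<And>v m. f v (m * k) = f v 0 + m * t"
    and "\<And>a b n. {a, b} \<in> E \<Longrightarrow> c a 1 < c b 1 \<Longrightarrow> f a n + 1 \<le> f b n \<and> f b n + 1 \<le> f a (n + 1)"
proof -
  define C where "C = (\<Union>i\<in>N. node_colors k c i)"
  define r where "r z = card {y \<in> C. y < z}" for z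
  define f where "f v n = r (c v (n mod k + 1)) + t * (n div k)" for v n
  have finC: "finite C"
    using G by (auto simp: C_def node_colors_def finite_simple_graph_def)
  have inC: "c v (n mod k + 1) \<in> C" if "v \<in> N" for v n
  proof -
    have "n mod k + 1 \<in> {1..k}" using k by (simp add: Suc_le_eq)
    then show ?thesis using that unfolding C_def node_colors_def by blast
  qed
  have r_less: "r y < r z" if "y \<in> C" "y < z" for y z
    unfolding r_def using that finC by (intro psubset_card_mono) auto
  have r_t: "r y < t" if "y \<in> C" for y
    unfolding r_def t C_def[symmetric] using that finC by (intro psubset_card_mono) auto
  show ?thesis
  proof (rule that)
    show "f v (m * k) = f v 0 + m * t" for v m
      using k by (simp add: f_def)
  next
    fix a b n assume e: "{a, b} \<in> E" and lt: "c a 1 < c b 1"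
    have N: "a \<in> N" "b \<in> N" using edge_nodes[OF G e] by auto
    have "alternates k c a b \<or> alternates k c b a"
      using col e by (simp add: interleaved_coloring_def)
    moreover have "\<not> alternates k c b a"
      using lt k by (auto simp: alternates_def not_less intro!: bexI[of _ 1])
    ultimately have alt: "alternates k c a b" by simp
    let ?s = "n mod k + 1"
    have s: "?s \<in> {1..k}" using k by (simp add: Suc_le_eq)
    have "c a ?s < c b ?s" using alt s by (simp add: alternates_def)
    then have 1: "f a n + 1 \<le> f b n"
      using r_less[OF inC[OF N(1)]] by (simp add: f_def Suc_le_eq)
    \<comment> \<open>Index \<open>n + 1\<close> of \<open>a\<close> opens a new round exactly when \<open>n mod k\<close> is the last residue.\<close>
    have 2: "f b n + 1 \<le> f a (n + 1)"
    proof (cases "Suc (n mod k) = k")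
      case True
      then have "f a (n + 1) = r (c a 1) + t * (n div k) + t"
        by (simp add: f_def mod_Suc div_Suc)
      then show ?thesis using r_t[OF inC[OF N(2), of n]] by (simp add: f_def)
    next
      case False
      then have "c b ?s < c a (?s + 1)" using alt s by (auto simp: alternates_def)
      then have "r (c b ?s) < r (c a (?s + 1))" using r_less[OF inC[OF N(2)]] by blast
      moreover have "f a (n + 1) = r (c a (?s + 1)) + t * (n div k)"
        using False by (simp add: f_def mod_Suc div_Suc)
      ultimately show ?thesis by (simp add: f_def)
    qed
    from 1 2 show "f a n + 1 \<le> f b n \<and> f b n + 1 \<le> f a (n + 1)" by simp
  qed
qed

text \<open>The orientation depends on \<open>k\<close>, namely on an optimal coloring for this \<open>k\<close>: edges point to
  the endpoint with the larger first color.\<close>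

lemma interleaved_chromatic_lower:
  assumes G: "finite_simple_graph N E" and k: "k \<ge> 1"
  obtains \<omega> where "\<omega> \<in> acyclic_orientations E"
    and "\<And>\<kappa>. \<kappa> \<in> simple_cycles E \<Longrightarrow>
      cycle_ratio \<kappa> \<omega> \<le> real (interleaved_chromatic N E k) / real k"
proof -
  define t where "t = interleaved_chromatic N E k"
  obtain c where col: "interleaved_coloring N E k c"
    and t: "t = card (\<Union>i\<in>N. node_colors k c i)"
    unfolding t_def using interleaved_chromatic_attained[OF G] by blast
  obtain f :: "'a \<Rightarrow> nat \<Rightarrow> nat" where per: "\<And>v m. f v (m * k) = f v 0 + m * t"
    and step: "\<And>a b n. {a, b} \<in> E \<Longrightarrow> c a 1 < c b 1 \<Longrightarrow>
      f a n + 1 \<le> f b n \<and> f b n + 1 \<le> f a (n + 1)"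
    using periodic_coloring[OF G k col t] by blast
  define \<omega> where "\<omega> = {(a, b). {a, b} \<in> E \<and> c a 1 < c b 1}"
  have neq: "c a 1 \<noteq> c b 1" if "{a, b} \<in> E" for a b
    using col that k by (force simp: interleaved_coloring_def alternates_def)
  have or: "orientation E \<omega>"
    using neq by (auto simp: orientation_def \<omega>_def insert_commute not_less_iff_gr_or_eq)
  have "acyclic \<omega>"
    by (rule wf_acyclic, rule wf_subset[OF wf_measure[of "\<lambda>v. c v 1"]]) (auto simp: \<omega>_def)
  then have ac: "\<omega> \<in> acyclic_orientations E" using or by (simp add: acyclic_orientations_def)
  have gain: "f a n + 1 \<le> f b (n + backward \<omega> a b)" if "{a, b} \<in> E" for a b n
    using step[of a b n] step[of b a n] neq[OF that] that
    by (auto simp: backward_def \<omega>_def insert_commute not_less_iff_gr_or_eq)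
  have one: "k * length \<kappa> \<le> t * forward_edges (rev \<kappa>) \<omega>" if "\<kappa> \<in> simple_cycles E" for \<kappa>
  proof -
    have "successively (\<lambda>a b. \<forall>n. f a n + 1 \<le> f b (n + backward \<omega> a b)) (\<kappa> @ [hd \<kappa>])"
      using simple_cycle_edges[OF that] by (rule successively_mono) (use gain in auto)
    moreover have "\<kappa> \<noteq> []" using that by (auto simp: simple_cycles_def)
    ultimately show ?thesis
      using closed_walk_gain[of \<kappa> f "backward \<omega>" k t] per backward_sum_cycle[OF or that] by simp
  qed
  have "cycle_ratio \<kappa> \<omega> \<le> real t / real k" if cyc: "\<kappa> \<in> simple_cycles E" for \<kappa>
  proof -
    let ?m = "min (forward_edges \<kappa> \<omega>) (forward_edges (rev \<kappa>) \<omega>)"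
    have "k * length \<kappa> \<le> t * ?m"
      using one[OF cyc] one[OF simple_cycles_rev[OF cyc]] by (simp add: min_def)
    then have "real k * real (length \<kappa>) \<le> real t * real ?m"
      by (metis of_nat_le_iff of_nat_mult)
    moreover have "real ?m > 0" using min_forward_edges_pos[OF ac cyc] by linarith
    ultimately show ?thesis
      unfolding cycle_ratio_def using k by (simp add: field_simps del: of_nat_min)
  qed
  with ac show ?thesis using that by (auto simp: t_def)
qed

lemma interleaved_chromatic_ge_2:
  assumes G: "finite_simple_graph N E" and E: "{i, j} \<in> E" and k: "k \<ge> 1"
  shows "2 \<le> real (interleaved_chromatic N E k) / real k"
proof -
  obtain c where col: "interleaved_coloring N E k c"
    and t: "interleaved_chromatic N E k = card (\<Union>i\<in>N. node_colors k c i)"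
    using interleaved_chromatic_attained[OF G] by blast
  have N: "i \<in> N" "j \<in> N" using edge_nodes[OF G E] by auto
  have card: "card (node_colors k c v) = k" if "v \<in> N" for v
    using col that by (simp add: interleaved_coloring_def tuple_coloring_def node_colors_def card_image)
  have "2 * k = card (node_colors k c i \<union> node_colors k c j)"
    using col E N by (subst card_Un_disjoint)
      (auto simp: card interleaved_coloring_def tuple_coloring_def finite_node_colors)
  also have "\<dots> \<le> interleaved_chromatic N E k"
    unfolding t using N G
    by (intro card_mono) (auto simp: node_colors_def finite_simple_graph_def)
  finally have "2 * real k \<le> real (interleaved_chromatic N E k)" by linarith
  then show ?thesis using k by (simp add: field_simps)
qed

lemma interleaved_multichromatic_ge:
  assumes "\<And>k. k \<ge> 1 \<Longrightarrow> b \<le> real (interleaved_chromatic N E k) / real k"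
  shows "b \<le> interleaved_multichromatic N E"
  unfolding interleaved_multichromatic_def using assms by (intro cINF_greatest) auto

theorem theorem4:
  fixes N :: "'a set" and E :: "'a set set"
  assumes "finite_simple_graph N E" and "card E \<ge> 1"
  shows "(simple_cycles E = {} \<longrightarrow> interleaved_multichromatic N E = 2) \<and>
         (simple_cycles E \<noteq> {} \<longrightarrow>
            interleaved_multichromatic N E =
              (MIN \<omega>\<in>acyclic_orientations E. MAX \<kappa>\<in>simple_cycles E. cycle_ratio \<kappa> \<omega>))"
proof (intro conjI impI)
  note G = assms(1)
  obtain e where "e \<in> E" using assms(2) by (metis card.empty ex_in_conv not_one_le_zero)
  moreover from this G have "card e = 2" by (auto simp: finite_simple_graph_def)
  ultimately obtain i j where ij: "{i, j} \<in> E" by (metis card_2_iff)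
  assume forest: "simple_cycles E = {}"
  obtain \<omega> where "\<omega> \<in> acyclic_orientations E" using acyclic_orientations_nonempty[OF G] by blast
  then have "interleaved_multichromatic N E \<le> 2"
    using forest by (intro interleaved_multichromatic_upper[OF G]) auto
  moreover have "2 \<le> interleaved_multichromatic N E"
    by (intro interleaved_multichromatic_ge interleaved_chromatic_ge_2[OF G ij])
  ultimately show "interleaved_multichromatic N E = 2" by simp
next
  note G = assms(1)
  assume cyc: "simple_cycles E \<noteq> {}"
  define M where "M \<omega> = (MAX \<kappa>\<in>simple_cycles E. cycle_ratio \<kappa> \<omega>)" for \<omega>
  note finc = finite_simple_cycles[OF G] and fino = finite_acyclic_orientations[OF G]
  have ratio_le: "cycle_ratio \<kappa> \<omega> \<le> M \<omega>" if "\<kappa> \<in> simple_cycles E" for \<kappa> \<omega>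
    unfolding M_def using that finc by (intro Max_ge) auto
  have "interleaved_multichromatic N E \<le> M \<omega>" if "\<omega> \<in> acyclic_orientations E" for \<omega>
  proof (rule interleaved_multichromatic_upper[OF G that _ ratio_le])
    obtain \<kappa> where "\<kappa> \<in> simple_cycles E" using cyc by blast
    then show "2 \<le> M \<omega>" using cycle_ratio_ge_2[OF that] ratio_le order_trans by blast
  qed
  then have "interleaved_multichromatic N E \<le> (MIN \<omega>\<in>acyclic_orientations E. M \<omega>)"
    using fino acyclic_orientations_nonempty[OF G] by (intro Min.boundedI) auto
  moreover have "(MIN \<omega>\<in>acyclic_orientations E. M \<omega>) \<le> interleaved_multichromatic N E"
  proof (rule interleaved_multichromatic_ge)
    fix k :: nat assume "k \<ge> 1"
    then obtain \<omega> where \<omega>: "\<omega> \<in> acyclic_orientations E"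
      and le: "\<And>\<kappa>. \<kappa> \<in> simple_cycles E \<Longrightarrow>
        cycle_ratio \<kappa> \<omega> \<le> real (interleaved_chromatic N E k) / real k"
      using interleaved_chromatic_lower[OF G] by blast
    have "(MIN \<omega>\<in>acyclic_orientations E. M \<omega>) \<le> M \<omega>"
      using \<omega> fino by (intro Min_le) auto
    also have "\<dots> \<le> real (interleaved_chromatic N E k) / real k"
      unfolding M_def using finc cyc le by (intro Max.boundedI) auto
    finally show "(MIN \<omega>\<in>acyclic_orientations E. M \<omega>) \<le> \<dots>" .
  qed
  ultimately show "interleaved_multichromatic N E =
      (MIN \<omega>\<in>acyclic_orientations E. MAX \<kappa>\<in>simple_cycles E. cycle_ratio \<kappa> \<omega>)"
    by (simp add: M_def)
qed

end
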